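(* There is a one-to-one correspondence between Manin triples of mock-pre-Lie algebras and phase spaces of mock-Lie algebras. More precisely, let $\omega(x+\xi,y+\eta)=\langle\xi,y\rangle-\langle\eta,x\rangle$ on $\mathfrak g\oplus\mathfrak g^*$. If $(\mathfrak g\oplus\mathfrak g^*,\mathfrak g,\mathfrak g^* )$ is a Manin triple of mock-pre-Lie algebras (with quadratic form $\omega$), then $(\mathfrak g\oplus\mathfrak g^*,\{\cdot,\cdot\},\omega)$ is a phase space of the mock-Lie algebra $(\mathfrak g,\{\cdot,\cdot\}_{\mathfrak g})$, where $\{\cdot,\cdot\}$ and $\{\cdot,\cdot\}_{\mathfrak g}$ are the sub-adjacent mock-Lie brackets of the mock-pre-Lie algebras $\mathfrak g\oplus\mathfrak g^*$ and $\mathfrak g$. Conversely, if $(\mathfrak g\oplus\mathfrak g^*,\{\cdot,\cdot\}_{\mathfrak g\oplus\mathfrak g^*},\omega)$ is a phase space of a mock-Lie algebra $(\mathfrak g,\{\cdot,\cdot\}_{\mathfrak g})$, then $(\mathfrak g\oplus\mathfrak g^*,\mathfrak g,\mathfrak g^* )$ is a Manin triple of mock-pre-Lie algebras, where the mock-pre-Lie product $\cdot$ on $\mathfrak g\oplus\mathfrak g^*$ is given by $\omega(u\cdot v,w)=\omega(v,\{u,w\}_{\mathfrak g\oplus\mathfrak g^*})$ for all $u,v,w\in\mathfrak g\oplus\mathfrak g^*$.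
   Context: All vector spaces are finite-dimensional over an algebraically closed field $\mathbb K$ of characteristic $0$; $\langle\cdot,\cdot\rangle$ is the natural pairing with the dual space. A mock-Lie algebra is a vector space with a symmetric bilinear bracket satisfying $\{x,\{y,z\}\}+\{y,\{z,x\}\}+\{z,\{x,y\}\}=0$. A mock-pre-Lie algebra is a vector space with a bilinear product satisfying $(x\cdot y)\cdot z+x\cdot(y\cdot z)=-(y\cdot x)\cdot z-y\cdot(x\cdot z)$; its sub-adjacent mock-Lie bracket is $\{x,y\}_c=x\cdot y+y\cdot x$. A symplectic mock-Lie algebra is a mock-Lie algebra with a nondegenerate skew-symmetric bilinear form $\omega$ satisfying $\omega(\{x,y\},z)+\omega(\{y,z\},x)+\omega(\{z,x\},y)=0$. A quadratic mock-pre-Lie algebra is a mock-pre-Lie algebra with a nondegenerate skew-symmetric bilinear form $\omega$ satisfying $\omega(x\cdot y,z)=\omega(y,\{x,z\}_c)$. A phase space of a mock-Lie algebra $(\mathfrak g,\{\cdot,\cdot\}_{\mathfrak g})$ is a symplectic mock-Lie algebra $(\mathfrak g\oplus\mathfrak g^*,\{\cdot,\cdot\},\omega)$ with $\omega(x+\xi,y+\eta)=\langle\xi,y\rangle-\langle\eta,x\rangle$, such that $(\mathfrak g,\{\cdot,\cdot\}_{\mathfrak g})$ and $(\mathfrak g^*,\{\cdot,\cdot\}|_{\mathfrak g^*})$ are mock-Lie subalgebras of it. A Manin triple of mock-pre-Lie algebras is a triple $(\mathcal G,\mathfrak g,\mathfrak g')$ where $(\mathcal G,\cdot,\omega)$ is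 a quadratic mock-pre-Lie algebra, $\mathfrak g$ and $\mathfrak g'$ are mock-pre-Lie subalgebras that are isotropic ($\omega(x,y)=0=\omega(u,v)$ for $x,y\in\mathfrak g$, $u,v\in\mathfrak g'$), and $\mathcal G=\mathfrak g\oplus\mathfrak g'$ as vector spaces. By nondegeneracy $\mathfrak g'$ is identified with $\mathfrak g^*$ via $\langle\xi,x\rangle=\omega(\xi,x)$, and under this identification $\mathcal G=\mathfrak g\oplus\mathfrak g^*$ and the form is the standard one $\omega(x+\xi,y+\eta)=\langle\xi,y\rangle-\langle\eta,x\rangle$. *)

theory Defs
  imports
    "HOL-Analysis.Product_Vector"
    "HOL-Computational_Algebra.Polynomial"
    "HOL-Library.Function_Algebras"
begin

(* Vector spaces are subspaces V of an ambient space given by its scalar multiplication.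
   Operations and forms on V are total functions of the ambient type; all conditions
   concern their values on V only. *)

locale fin_dim_space = vector_space sc
  for sc :: "'k::field \<Rightarrow> 'b::ab_group_add \<Rightarrow> 'b" +
  fixes V :: "'b set"
  assumes subspace_V: "subspace V"
    and fin_dim_V: "\<exists>B. finite B \<and> B \<subseteq> V \<and> V = span B"

definition bilinear_on ::
  "('k \<Rightarrow> 'b::plus \<Rightarrow> 'b) \<Rightarrow> 'b set \<Rightarrow> ('k \<Rightarrow> 'c::plus \<Rightarrow> 'c) \<Rightarrow> 'c set \<Rightarrow> ('b \<Rightarrow> 'b \<Rightarrow> 'c) \<Rightarrow> bool"
  where "bilinear_on s V t W f \<longleftrightarrow>
    (\<forall>x\<in>V. \<forall>y\<in>V. f x y \<in> W) \<and>
    (\<forall>x\<in>V. \<forall>y\<in>V. \<forall>z\<in>V. f (x + y) z = f x z + f y z \<and> f x (y + z) = f x y + f x z) \<and>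
    (\<forall>c. \<forall>x\<in>V. \<forall>y\<in>V. f (s c x) y = t c (f x y) \<and> f x (s c y) = t c (f x y))"

locale mock_Lie_algebra = fin_dim_space sc V
  for sc :: "'k::field \<Rightarrow> 'b::ab_group_add \<Rightarrow> 'b" and V +
  fixes br :: "'b \<Rightarrow> 'b \<Rightarrow> 'b"
  assumes bilinear_br: "bilinear_on sc V sc V br"
    and br_sym: "\<And>x y. \<lbrakk>x \<in> V; y \<in> V\<rbrakk> \<Longrightarrow> br x y = br y x"
    and br_jacobi: "\<And>x y z. \<lbrakk>x \<in> V; y \<in> V; z \<in> V\<rbrakk> \<Longrightarrow>
          br x (br y z) + br y (br z x) + br z (br x y) = 0"

locale mock_pre_Lie_algebra = fin_dim_space sc V
  for sc :: "'k::field \<Rightarrow> 'b::ab_group_add \<Rightarrow> 'b" and V +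
  fixes P :: "'b \<Rightarrow> 'b \<Rightarrow> 'b"
  assumes bilinear_P: "bilinear_on sc V sc V P"
    and mock_pre_Lie: "\<And>x y z. \<lbrakk>x \<in> V; y \<in> V; z \<in> V\<rbrakk> \<Longrightarrow>
          P (P x y) z + P x (P y z) = - P (P y x) z - P y (P x z)"

definition sub_adjacent :: "('b::plus \<Rightarrow> 'b \<Rightarrow> 'b) \<Rightarrow> 'b \<Rightarrow> 'b \<Rightarrow> 'b"
  where "sub_adjacent P x y = P x y + P y x"

definition subalgebra ::
  "('k::field \<Rightarrow> 'b::ab_group_add \<Rightarrow> 'b) \<Rightarrow> 'b set \<Rightarrow> ('b \<Rightarrow> 'b \<Rightarrow> 'b) \<Rightarrow> 'b set \<Rightarrow> bool"
  where "subalgebra sc V m H \<longleftrightarrow>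
    module.subspace sc H \<and> H \<subseteq> V \<and> (\<forall>x\<in>H. \<forall>y\<in>H. m x y \<in> H)"

locale skew_form_space = fin_dim_space sc V
  for sc :: "'k::field \<Rightarrow> 'b::ab_group_add \<Rightarrow> 'b" and V +
  fixes \<omega> :: "'b \<Rightarrow> 'b \<Rightarrow> 'k"
  assumes bilinear_form: "bilinear_on sc V (*) UNIV \<omega>"
    and skew: "\<And>x y. \<lbrakk>x \<in> V; y \<in> V\<rbrakk> \<Longrightarrow> \<omega> x y = - \<omega> y x"
    and nondegenerate: "\<And>x. \<lbrakk>x \<in> V; \<forall>y\<in>V. \<omega> x y = 0\<rbrakk> \<Longrightarrow> x = 0"

locale symplectic_mock_Lie_algebra =
  mock_Lie_algebra sc V br + skew_form_space sc V \<omega>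
  for sc :: "'k::field \<Rightarrow> 'b::ab_group_add \<Rightarrow> 'b" and V br \<omega> +
  assumes symplectic: "\<And>x y z. \<lbrakk>x \<in> V; y \<in> V; z \<in> V\<rbrakk> \<Longrightarrow>
    \<omega> (br x y) z + \<omega> (br y z) x + \<omega> (br z x) y = 0"

locale quadratic_mock_pre_Lie_algebra =
  mock_pre_Lie_algebra sc V P + skew_form_space sc V \<omega>
  for sc :: "'k::field \<Rightarrow> 'b::ab_group_add \<Rightarrow> 'b" and V P \<omega> +
  assumes quadratic: "\<And>x y z. \<lbrakk>x \<in> V; y \<in> V; z \<in> V\<rbrakk> \<Longrightarrow>
    \<omega> (P x y) z = \<omega> y (sub_adjacent P x z)"

locale Manin_triple = quadratic_mock_pre_Lie_algebra sc G P \<omega>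
  for sc :: "'k::field \<Rightarrow> 'b::ab_group_add \<Rightarrow> 'b" and G P \<omega> +
  fixes g g' :: "'b set"
  assumes subalgebra_g: "subalgebra sc G P g"
    and subalgebra_g': "subalgebra sc G P g'"
    and isotropic_g: "\<And>x y. \<lbrakk>x \<in> g; y \<in> g\<rbrakk> \<Longrightarrow> \<omega> x y = 0"
    and isotropic_g': "\<And>x y. \<lbrakk>x \<in> g'; y \<in> g'\<rbrakk> \<Longrightarrow> \<omega> x y = 0"
    and direct_sum: "G = {x + y |x y. x \<in> g \<and> y \<in> g'}" "g \<inter> g' = {0}"

(* From here on g is the whole type 'v, and g* is the set of linear functionals on it.
   The functionals are a proper subset of 'v => 'k, so g + g* is a subspace of the
   ambient space 'v * ('v => 'k). *)

definition dual_space :: "('k::field \<Rightarrow> 'v::ab_group_add \<Rightarrow> 'v) \<Rightarrow> ('v \<Rightarrow> 'k) set"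
  where "dual_space sc = {\<xi>. Vector_Spaces.linear sc (*) \<xi>}"

definition dsum_scale ::
  "('k::field \<Rightarrow> 'v::ab_group_add \<Rightarrow> 'v) \<Rightarrow> 'k \<Rightarrow> 'v \<times> ('v \<Rightarrow> 'k) \<Rightarrow> 'v \<times> ('v \<Rightarrow> 'k)"
  where "dsum_scale sc = module_prod.scale sc (\<lambda>c \<xi> x. c * \<xi> x)"

definition dsum :: "('k::field \<Rightarrow> 'v::ab_group_add \<Rightarrow> 'v) \<Rightarrow> ('v \<times> ('v \<Rightarrow> 'k)) set"
  where "dsum sc = UNIV \<times> dual_space sc"

definition base_part :: "('v \<times> ('v \<Rightarrow> 'k::field)) set"
  where "base_part = UNIV \<times> {0}"

definition dual_part :: "('k::field \<Rightarrow> 'v::ab_group_add \<Rightarrow> 'v) \<Rightarrow> ('v \<times> ('v \<Rightarrow> 'k)) set"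
  where "dual_part sc = {0} \<times> dual_space sc"

definition std_form :: "'v \<times> ('v \<Rightarrow> 'k) \<Rightarrow> 'v \<times> ('v \<Rightarrow> 'k) \<Rightarrow> 'k::field"
  where "std_form = (\<lambda>(x, \<xi>) (y, \<eta>). \<xi> y - \<eta> x)"

(* The operation induced on g by an operation on g + g*; it is meant for operations
   under which base_part is closed, where the discarded component is 0. *)
definition induced_op ::
  "('v \<times> ('v \<Rightarrow> 'k) \<Rightarrow> 'v \<times> ('v \<Rightarrow> 'k) \<Rightarrow> 'v \<times> ('v \<Rightarrow> 'k::field)) \<Rightarrow> 'v \<Rightarrow> 'v \<Rightarrow> 'v"
  where "induced_op m x y = fst (m (x, 0) (y, 0))"

definition phase_space ::
  "('k::field \<Rightarrow> 'v::ab_group_add \<Rightarrow> 'v) \<Rightarrow> ('v \<Rightarrow> 'v \<Rightarrow> 'v) \<Rightarrow>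
   ('v \<times> ('v \<Rightarrow> 'k) \<Rightarrow> 'v \<times> ('v \<Rightarrow> 'k) \<Rightarrow> 'v \<times> ('v \<Rightarrow> 'k)) \<Rightarrow> bool"
  where "phase_space sc bg br \<longleftrightarrow>
    mock_Lie_algebra sc UNIV bg \<and>
    symplectic_mock_Lie_algebra (dsum_scale sc) (dsum sc) br std_form \<and>
    subalgebra (dsum_scale sc) (dsum sc) br base_part \<and>
    (\<forall>x y. br (x, 0) (y, 0) = (bg x y, 0)) \<and>
    subalgebra (dsum_scale sc) (dsum sc) br (dual_part sc)"

abbreviation std_Manin_triple ::
  "('k::field \<Rightarrow> 'v::ab_group_add \<Rightarrow> 'v) \<Rightarrow>
   ('v \<times> ('v \<Rightarrow> 'k) \<Rightarrow> 'v \<times> ('v \<Rightarrow> 'k) \<Rightarrow> 'v \<times> ('v \<Rightarrow> 'k)) \<Rightarrow> bool"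
  where "std_Manin_triple sc P \<equiv>
    Manin_triple (dsum_scale sc) (dsum sc) P std_form base_part (dual_part sc)"

(* u . v is the element of D determined by \<omega>(u . v, w) = \<omega>(v, {u, w}) for all w in D *)
definition product_of_bracket ::
  "'b set \<Rightarrow> ('b \<Rightarrow> 'b \<Rightarrow> 'k) \<Rightarrow> ('b \<Rightarrow> 'b \<Rightarrow> 'b) \<Rightarrow> ('b \<Rightarrow> 'b \<Rightarrow> 'b) \<Rightarrow> bool"
  where "product_of_bracket D \<omega> br P \<longleftrightarrow>
    (\<forall>u\<in>D. \<forall>v\<in>D. P u v \<in> D \<and> (\<forall>w\<in>D. \<omega> (P u v) w = \<omega> v (br u w)))"

(* Operations on D are represented by total functions; requiring the value 0 outside D
   makes the representative unique, which counting (uniqueness, bijections) needs. *)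
definition zero_off :: "'b set \<Rightarrow> ('b \<Rightarrow> 'b \<Rightarrow> 'b::zero) \<Rightarrow> bool"
  where "zero_off D m \<longleftrightarrow> (\<forall>u v. u \<notin> D \<or> v \<notin> D \<longrightarrow> m u v = 0)"

end

theory Submission
  imports Defs
begin

text \<open>In a quadratic mock-pre-Lie algebra the product is determined by its sub-adjacent bracket
  through \<open>\<omega>(x \<cdot> y, z) = \<omega>(y, {x, z})\<close>. Conversely, nondegeneracy turns this formula into a
  definition of the product from a symplectic bracket; symplecticity then says that the new
  product has the given sub-adjacent bracket, and the Jacobi identity, paired with \<open>\<omega>\<close>, is the
  mock-pre-Lie identity. Subalgebras correspond because both summands of \<open>g + g*\<close> are
  Lagrangian: \<open>x \<cdot> y\<close> pairs to zero with the summand containing \<open>x\<close> and \<open>y\<close>,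
  hence lies in it.\<close>

section \<open>Nondegenerate skew forms\<close>

context skew_form_space
begin

lemma form_add [simp]:
  assumes "x \<in> V" "y \<in> V" "z \<in> V"
  shows "\<omega> (x + y) z = \<omega> x z + \<omega> y z" "\<omega> x (y + z) = \<omega> x y + \<omega> x z"
  using bilinear_form assms unfolding bilinear_on_def by blast+

lemma form_scale [simp]:
  assumes "x \<in> V" "y \<in> V"
  shows "\<omega> (sc c x) y = c * \<omega> x y" "\<omega> x (sc c y) = c * \<omega> x y"
  using bilinear_form assms unfolding bilinear_on_def by blast+

lemma form_zero [simp]:
  assumes "x \<in> V"
  shows "\<omega> 0 x = 0" "\<omega> x 0 = 0"
  using form_scale[OF assms assms, of 0] by simp_all

lemma form_uminus [simp]:
  assumes "x \<in> V" "y \<in> V"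
  shows "\<omega> (- x) y = - \<omega> x y"
  using form_scale(1)[OF assms, of "-1"] by simp

lemma eq_by_form:
  assumes "x \<in> V" "y \<in> V" "\<And>z. z \<in> V \<Longrightarrow> \<omega> x z = \<omega> y z"
  shows "x = y"
proof -
  have y: "- y \<in> V" using assms(2) subspace_V by (rule subspace_neg[rotated])
  have "x + - y = 0"
  proof (rule nondegenerate)
    show "x + - y \<in> V" using subspace_V assms(1) y by (rule subspace_add)
    show "\<forall>z\<in>V. \<omega> (x + - y) z = 0"
      using assms form_add(1)[OF assms(1) y] by (simp del: add_uminus_conv_diff)
  qed
  then show ?thesis by simp
qed

text \<open>Nondegeneracy makes the product belonging to a bracket unique on \<open>V\<close>. This
  gives both the uniqueness in \<open>ex1_product_of_bracket\<close> and the injectivity of the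
  correspondence.\<close>

lemma product_of_bracket_cong:
  assumes "product_of_bracket V \<omega> br P" "product_of_bracket V \<omega> br' Q"
    and "\<And>u v. \<lbrakk>u \<in> V; v \<in> V\<rbrakk> \<Longrightarrow> br u v = br' u v" "u \<in> V" "v \<in> V"
  shows "P u v = Q u v"
  using assms unfolding product_of_bracket_def by (intro eq_by_form) auto

end

section \<open>From products to brackets\<close>

lemma (in mock_pre_Lie_algebra) mock_Lie_sub_adjacent:
  "mock_Lie_algebra sc V (sub_adjacent P)"
proof
  have PV [simp]: "P x y \<in> V" if "x \<in> V" "y \<in> V" for x y
    using bilinear_P that unfolding bilinear_on_def by blast
  have P_add [simp]: "P (x + y) z = P x z + P y z" "P x (y + z) = P x y + P x z"
    if "x \<in> V" "y \<in> V" "z \<in> V" for x y z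
    using bilinear_P that unfolding bilinear_on_def by blast+
  have P_scale: "P (sc c x) y = sc c (P x y)" "P x (sc c y) = sc c (P x y)"
    if "x \<in> V" "y \<in> V" for c x y
    using bilinear_P that unfolding bilinear_on_def by blast+
  have plus [simp]: "x + y \<in> V" if "x \<in> V" "y \<in> V" for x y
    using that subspace_V by (rule subspace_add[rotated])
  show "bilinear_on sc V sc V (sub_adjacent P)"
    unfolding bilinear_on_def sub_adjacent_def
    by (auto simp: P_scale scale_right_distrib add_ac)
  show "sub_adjacent P x y = sub_adjacent P y x" for x y
    by (simp add: sub_adjacent_def add_ac)
  fix x y z assume xyz: "x \<in> V" "y \<in> V" "z \<in> V"
  have A: "P (P a b) c + P a (P b c) + (P (P b a) c + P b (P a c)) = 0"
    if "a \<in> V" "b \<in> V" "c \<in> V" for a b c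
    using mock_pre_Lie[OF that] by simp
  \<comment> \<open>Bilinearity expands the Jacobi sum into twelve terms, grouped here into the
    mock-pre-Lie identities for the three cyclic rotations of \<open>x, y, z\<close>.\<close>
  have "sub_adjacent P x (sub_adjacent P y z) + sub_adjacent P y (sub_adjacent P z x)
      + sub_adjacent P z (sub_adjacent P x y)
    = (P (P x y) z + P x (P y z) + (P (P y x) z + P y (P x z)))
      + (P (P y z) x + P y (P z x) + (P (P z y) x + P z (P y x)))
      + (P (P z x) y + P z (P x y) + (P (P x z) y + P x (P z y)))"
    using xyz by (simp add: sub_adjacent_def add_ac)
  also have "\<dots> = 0" using xyz by (simp only: A add_0)
  finally show "sub_adjacent P x (sub_adjacent P y z) + sub_adjacent P y (sub_adjacent P z x)
      + sub_adjacent P z (sub_adjacent P x y) = 0" .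
qed

text \<open>The quadratic condition moves each of the two products in the bracket of
  \<open>x\<close> and \<open>y\<close> across the form; skewness then turns the results into the
  other two cyclic terms with a minus sign.\<close>

lemma (in quadratic_mock_pre_Lie_algebra) symplectic_sub_adjacent:
  "symplectic_mock_Lie_algebra sc V (sub_adjacent P) \<omega>"
proof -
  interpret L: mock_Lie_algebra sc V "sub_adjacent P"
    by (rule mock_Lie_sub_adjacent)
  have PV [simp]: "P x y \<in> V" "sub_adjacent P x y \<in> V" if "x \<in> V" "y \<in> V" for x y
    using bilinear_P L.bilinear_br that unfolding bilinear_on_def by blast+
  show ?thesis
  proof
    fix x y z assume xyz: "x \<in> V" "y \<in> V" "z \<in> V"
    have "\<omega> (sub_adjacent P x y) z = \<omega> (P x y) z + \<omega> (P y x) z"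
      using xyz by (simp add: sub_adjacent_def)
    also have "\<dots> = \<omega> y (sub_adjacent P z x) + \<omega> x (sub_adjacent P y z)"
      using xyz by (simp add: quadratic L.br_sym)
    also have "\<dots> = - \<omega> (sub_adjacent P z x) y - \<omega> (sub_adjacent P y z) x"
      using xyz skew[of y "sub_adjacent P z x"] skew[of x "sub_adjacent P y z"] by simp
    finally show "\<omega> (sub_adjacent P x y) z + \<omega> (sub_adjacent P y z) x
        + \<omega> (sub_adjacent P z x) y = 0"
      by simp
  qed
qed

lemma (in quadratic_mock_pre_Lie_algebra) product_of_sub_adjacent:
  "product_of_bracket V \<omega> (sub_adjacent P) P"
  using quadratic bilinear_P unfolding product_of_bracket_def bilinear_on_def by blast

lemma zero_off_sub_adjacent:
  fixes P :: "'b::ab_group_add \<Rightarrow> 'b \<Rightarrow> 'b"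
  assumes "zero_off V P"
  shows "zero_off V (sub_adjacent P)"
  using assms by (auto simp: zero_off_def sub_adjacent_def)

section \<open>From symplectic brackets to products\<close>

context symplectic_mock_Lie_algebra
begin

lemma br_closed [simp]: "\<lbrakk>x \<in> V; y \<in> V\<rbrakk> \<Longrightarrow> br x y \<in> V"
  using bilinear_br unfolding bilinear_on_def by blast

lemma br_add:
  assumes "x \<in> V" "y \<in> V" "z \<in> V"
  shows "br (x + y) z = br x z + br y z" "br x (y + z) = br x y + br x z"
  using bilinear_br assms unfolding bilinear_on_def by blast+

lemma br_scale:
  assumes "x \<in> V" "y \<in> V"
  shows "br (sc c x) y = sc c (br x y)" "br x (sc c y) = sc c (br x y)"
  using bilinear_br assms unfolding bilinear_on_def by blast+

lemma product_of_bracketD: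
  assumes "product_of_bracket V \<omega> br P" "u \<in> V" "v \<in> V"
  shows "P u v \<in> V" "w \<in> V \<Longrightarrow> \<omega> (P u v) w = \<omega> v (br u w)"
  using assms unfolding product_of_bracket_def by blast+

text \<open>The computation of \<open>symplectic_sub_adjacent\<close> run backwards: paired with
  \<open>w\<close>, the left side is minus two of the three cyclic terms, and symplecticity supplies
  the third.\<close>

lemma sub_adjacent_product:
  assumes P: "product_of_bracket V \<omega> br P" and uv: "u \<in> V" "v \<in> V"
  shows "sub_adjacent P u v = br u v"
proof (rule eq_by_form)
  note [simp] = product_of_bracketD[OF P] subspace_add[OF subspace_V]
  show "sub_adjacent P u v \<in> V" "br u v \<in> V"
    using uv by (simp_all add: sub_adjacent_def)
  fix w assume w: "w \<in> V"
  have "\<omega> (sub_adjacent P u v) w = \<omega> v (br w u) + \<omega> u (br v w)"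
    using uv w by (simp add: sub_adjacent_def br_sym)
  also have "\<dots> = - \<omega> (br w u) v - \<omega> (br v w) u"
    using uv w skew[of v "br w u"] skew[of u "br v w"] by simp
  also have "\<dots> = \<omega> (br u v) w"
    using symplectic[OF uv w] by algebra
  finally show "\<omega> (sub_adjacent P u v) w = \<omega> (br u v) w" .
qed

lemma quadratic_product:
  assumes P: "product_of_bracket V \<omega> br P"
  shows "quadratic_mock_pre_Lie_algebra sc V P \<omega>"
proof
  note [simp] = product_of_bracketD[OF P] subspace_add[OF subspace_V]
    subspace_scale[OF subspace_V] subspace_neg[OF subspace_V]
  \<comment> \<open>Left multiplication \<open>P u\<close> is the transpose of \<open>br u\<close>
    under the form, so linearity in each argument is inherited from \<open>br\<close> after
    pairing.\<close>
  have P_add: "P (x + y) z = P x z + P y z" "P x (y + z) = P x y + P x z"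
    if "x \<in> V" "y \<in> V" "z \<in> V" for x y z
    by (rule eq_by_form; use that in \<open>simp add: br_add\<close>)+
  have P_scale: "P (sc c x) y = sc c (P x y)" "P x (sc c y) = sc c (P x y)"
    if "x \<in> V" "y \<in> V" for c x y
    by (rule eq_by_form; use that in \<open>simp add: br_scale\<close>)+
  show "bilinear_on sc V sc V P"
    unfolding bilinear_on_def by (simp add: P_add P_scale)
  show "\<omega> (P x y) z = \<omega> y (sub_adjacent P x z)" if "x \<in> V" "y \<in> V" "z \<in> V" for x y z
    using that by (simp add: sub_adjacent_product[OF P])
  fix x y z assume xyz: "x \<in> V" "y \<in> V" "z \<in> V"
  \<comment> \<open>This is the mock-pre-Lie identity with \<open>P x y + P y x\<close> collected
    into \<open>br x y\<close>. Paired with \<open>w\<close>, every left multiplication moves onto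
    \<open>w\<close>, in reversed order, and leaves the Jacobi sum of \<open>x\<close>,
    \<open>y\<close>, \<open>w\<close> paired with \<open>z\<close>.\<close>
  have "P (br x y) z + (P x (P y z) + P y (P x z)) = 0"
  proof (rule eq_by_form)
    fix w assume w: "w \<in> V"
    have "br (br x y) w + (br y (br x w) + br x (br y w)) = 0"
      using br_jacobi[OF xyz(1,2) w] xyz w by (simp add: br_sym add_ac)
    then have "\<omega> z (br (br x y) w + (br y (br x w) + br x (br y w))) = 0"
      using xyz by simp
    then show "\<omega> (P (br x y) z + (P x (P y z) + P y (P x z))) w = \<omega> 0 w"
      using xyz w by simp
  qed (use xyz subspace_0[OF subspace_V] in simp_all)
  then have "P (P x y) z + P x (P y z) + (P (P y x) z + P y (P x z)) = 0"
    using xyz P_add(1)[of "P x y" "P y x" z]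
    by (simp add: sub_adjacent_product[OF P, symmetric] sub_adjacent_def add_ac)
  then have "P (P x y) z + P x (P y z) = - (P (P y x) z + P y (P x z))"
    by (simp only: eq_neg_iff_add_eq_0)
  then show "P (P x y) z + P x (P y z) = - P (P y x) z - P y (P x z)"
    by simp
qed

end

section \<open>The space g + g* with its standard form\<close>

lemma dsum_scale_Pair:
  fixes sc :: "'k::field \<Rightarrow> 'v::ab_group_add \<Rightarrow> 'v"
  assumes "vector_space sc"
  shows "dsum_scale sc c (x, \<xi>) = (sc c x, \<lambda>y. c * \<xi> y)"
proof -
  interpret vector_space sc by fact
  interpret module_prod sc "\<lambda>c (\<xi>::'v \<Rightarrow> 'k) y. c * \<xi> y"
    by unfold_locales (auto simp: fun_eq_iff algebra_simps)
  show ?thesis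
    by (simp add: dsum_scale_def scale_prod)
qed

lemma mem_dual_space:
  fixes sc :: "'k::field \<Rightarrow> 'v::ab_group_add \<Rightarrow> 'v"
  assumes "vector_space sc"
  shows "\<xi> \<in> dual_space sc \<longleftrightarrow>
    (\<forall>x y. \<xi> (x + y) = \<xi> x + \<xi> y) \<and> (\<forall>c x. \<xi> (sc c x) = c * \<xi> x)"
proof -
  have "vector_space ((*) :: 'k \<Rightarrow> 'k \<Rightarrow> 'k)"
    by unfold_locales (simp_all add: algebra_simps)
  then show ?thesis using assms by (auto simp: dual_space_def Vector_Spaces.linear_iff)
qed

lemma zero_mem_dual_space: "vector_space sc \<Longrightarrow> 0 \<in> dual_space sc"
  by (simp add: mem_dual_space)

lemma base_part_subset: "vector_space sc \<Longrightarrow> base_part \<subseteq> dsum sc"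
  by (auto simp: base_part_def dsum_def zero_mem_dual_space)

lemma dual_part_subset: "dual_part sc \<subseteq> dsum sc"
  by (auto simp: dual_part_def dsum_def)

text \<open>Pairing with \<open>(y, 0)\<close> evaluates the functional component of
  \<open>p\<close> at \<open>y\<close>, so that component vanishes.\<close>

lemma base_part_perp:
  assumes "\<And>q. q \<in> base_part \<Longrightarrow> std_form p q = 0"
  shows "p \<in> base_part"
  using assms[of "(_, 0)"] by (cases p) (auto simp: base_part_def std_form_def fun_eq_iff)

text \<open>Here one must know that functionals separate points of g. This is extracted from the
  assumed nondegeneracy of \<open>std_form\<close>, without choosing a basis.\<close>

lemma dual_part_perp:
  assumes "skew_form_space (dsum_scale sc) (dsum sc) std_form" "vector_space sc"
    and p: "p \<in> dsum sc" "\<And>q. q \<in> dual_part sc \<Longrightarrow> std_form p q = 0"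
  shows "p \<in> dual_part sc"
proof -
  interpret skew_form_space "dsum_scale sc" "dsum sc" std_form by fact
  obtain x \<xi> where [simp]: "p = (x, \<xi>)" by (cases p)
  \<comment> \<open>The pairing of \<open>(x, 0)\<close> with \<open>(y, \<eta>)\<close> is
    \<open>- \<eta> x\<close>, which is also the pairing of \<open>p\<close> with
    \<open>(0, \<eta>)\<close> and hence zero.\<close>
  have "(x, 0) = (0 :: 'b \<times> ('b \<Rightarrow> 'a))"
  proof (rule nondegenerate)
    show "(x, 0) \<in> dsum sc"
      using base_part_subset[OF assms(2)] by (auto simp: base_part_def)
    show "\<forall>q\<in>dsum sc. std_form (x, 0) q = 0"
    proof
      fix q assume "q \<in> dsum sc"
      moreover obtain y \<eta> where "q = (y, \<eta>)" by (cases q)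
      ultimately show "std_form (x, 0) q = 0"
        using p(2)[of "(0, \<eta>)"] p(1) assms(2)
        by (auto simp: dual_part_def dsum_def std_form_def mem_dual_space)
          (metis add_0 add_cancel_left_left)
    qed
  qed
  then show ?thesis using p(1) by (auto simp: dual_part_def dsum_def zero_prod_def)
qed

lemma dsum_direct_sum:
  assumes "vector_space sc"
  shows "dsum sc = {x + y |x y. x \<in> base_part \<and> y \<in> dual_part sc}"
    and "base_part \<inter> dual_part sc = {0}"
proof -
  show "base_part \<inter> dual_part sc = {0}"
    using zero_mem_dual_space[OF assms] by (auto simp: base_part_def dual_part_def zero_prod_def)
  have "\<exists>q r. p = q + r \<and> q \<in> base_part \<and> r \<in> dual_part sc" if "p \<in> dsum sc" for p
    by (rule exI[of _ "(fst p, 0)"], rule exI[of _ "(0, snd p)"])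
      (use that in \<open>auto simp: base_part_def dual_part_def dsum_def\<close>)
  then show "dsum sc = {x + y |x y. x \<in> base_part \<and> y \<in> dual_part sc}"
    by (auto simp: base_part_def dual_part_def dsum_def)
qed

lemma std_form_isotropic:
  assumes "vector_space sc"
  shows "p \<in> base_part \<Longrightarrow> q \<in> base_part \<Longrightarrow> std_form p q = 0"
    and "p \<in> dual_part sc \<Longrightarrow> q \<in> dual_part sc \<Longrightarrow> std_form p q = 0"
proof -
  have "\<xi> 0 = 0" if "\<xi> \<in> dual_space sc" for \<xi>
    using that assms unfolding mem_dual_space[OF assms] by (metis add_cancel_right_right)
  then show "p \<in> dual_part sc \<Longrightarrow> q \<in> dual_part sc \<Longrightarrow> std_form p q = 0"
    by (auto simp: dual_part_def std_form_def) metis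
qed (auto simp: base_part_def std_form_def)

text \<open>Expanding a functional in the dual basis reduces representability to the
  coordinates of the two summands, so no dimension count of \<open>g + g*\<close> is needed.\<close>

lemma std_form_represents:
  fixes sc :: "'k::field \<Rightarrow> 'v::ab_group_add \<Rightarrow> 'v"
  assumes "finite_dimensional_vector_space sc B"
    and add: "\<And>p q. \<lbrakk>p \<in> dsum sc; q \<in> dsum sc\<rbrakk> \<Longrightarrow> f (p + q) = f p + f q"
    and scale: "\<And>c p. p \<in> dsum sc \<Longrightarrow> f (dsum_scale sc c p) = c * f p"
  shows "\<exists>p\<in>dsum sc. \<forall>q\<in>dsum sc. std_form p q = f q"
proof -
  interpret finite_dimensional_vector_space sc B by fact
  note mem = mem_dual_space[OF vector_space_axioms]
  note dscale = dsum_scale_Pair[OF vector_space_axioms]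
  \<comment> \<open>The dual basis: \<open>\<beta> b\<close> is the coordinate functional of the
    basis vector \<open>b\<close>.\<close>
  define \<beta> where "\<beta> b y = representation B y b" for b y
  have \<beta>: "\<beta> b \<in> dual_space sc" for b
    using linear_representation[OF independent_Basis span_Basis]
    by (simp add: \<beta>_def[abs_def] dual_space_def)
  \<comment> \<open>Additivity of \<open>f\<close> is known only on \<open>dsum sc\<close>, so the
    induction must also carry membership of the partial sums in the dual space.\<close>
  have sums: "(\<lambda>y. \<Sum>b\<in>S. c b * \<beta> b y) \<in> dual_space sc \<and>
      f (0, \<lambda>y. \<Sum>b\<in>S. c b * \<beta> b y) = (\<Sum>b\<in>S. c b * f (0, \<beta> b))" if "finite S" for S c
    using that
  proof induction
    case empty
    show ?case
      using scale[of "(0, 0)" 0] zero_mem_dual_space[OF vector_space_axioms]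
      by (simp add: mem dsum_def dscale)
  next
    case (insert b S)
    let ?\<eta> = "\<lambda>y. \<Sum>b\<in>S. c b * \<beta> b y" and ?\<xi> = "\<lambda>y. c b * \<beta> b y"
    have eq: "(\<lambda>y. \<Sum>b\<in>insert b S. c b * \<beta> b y) = (\<lambda>y. ?\<xi> y + ?\<eta> y)"
      using insert by simp
    have \<xi>: "?\<xi> \<in> dual_space sc"
      using \<beta>[of b] by (auto simp: mem algebra_simps)
    have "f (0, \<lambda>y. ?\<xi> y + ?\<eta> y) = f ((0, ?\<xi>) + (0, ?\<eta>))"
      by (simp add: plus_fun_def)
    also have "\<dots> = f (0, ?\<xi>) + f (0, ?\<eta>)"
      using \<xi> insert by (intro add) (auto simp: dsum_def)
    also have "f (0, ?\<xi>) = c b * f (0, \<beta> b)"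
      using scale[of "(0, \<beta> b)" "c b"] \<beta> by (simp add: dscale dsum_def)
    finally show ?case
      using insert \<xi> unfolding eq by (auto simp: mem algebra_simps)
  qed
  \<comment> \<open>The form at \<open>(x, \<xi>)\<close> and \<open>(y, \<eta>)\<close> is
    \<open>\<xi> y - \<eta> x\<close> and has to equal \<open>f (y, 0) + f (0, \<eta>)\<close>.
    Hence \<open>\<xi>\<close> is \<open>f\<close> on the base part, and the coordinates of
    \<open>x\<close> are the values of \<open>f\<close> on the dual basis with opposite
    sign.\<close>
  define x where "x = - (\<Sum>b\<in>B. sc (f (0, \<beta> b)) b)"
  define \<xi> where "\<xi> y = f (y, 0)" for y
  have z: "(y, 0) \<in> dsum sc" for y
    using zero_mem_dual_space[OF vector_space_axioms] by (simp add: dsum_def)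
  have \<xi>: "\<xi> \<in> dual_space sc"
    unfolding mem \<xi>_def
    using add[OF z z] scale[OF z] by (simp add: dscale flip: zero_fun_def)
  show ?thesis
  proof (intro bexI[of _ "(x, \<xi>)"] ballI)
    show "(x, \<xi>) \<in> dsum sc" using \<xi> by (simp add: dsum_def)
    fix q assume q: "q \<in> dsum sc"
    obtain y \<eta> where [simp]: "q = (y, \<eta>)" by (cases q)
    have \<eta>: "\<eta> \<in> dual_space sc" using q by (simp add: dsum_def)
    then interpret \<eta>: Vector_Spaces.linear sc "(*)" \<eta> by (simp add: dual_space_def)
    have "(\<Sum>b\<in>B. \<eta> b * \<beta> b v) = \<eta> v" for v
    proof -
      have "v = (\<Sum>b\<in>B. sc (\<beta> b v) b)"
        using sum_representation_eq[OF independent_Basis, of v B] span_Basis finite_Basis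
        by (simp add: \<beta>_def)
      then have "\<eta> v = \<eta> (\<Sum>b\<in>B. sc (\<beta> b v) b)" by simp
      also have "\<dots> = (\<Sum>b\<in>B. \<eta> b * \<beta> b v)"
        by (simp add: \<eta>.sum \<eta>.scale mult.commute)
      finally show ?thesis by (rule sym)
    qed
    then have eta: "(\<lambda>v. \<Sum>b\<in>B. \<eta> b * \<beta> b v) = \<eta>" by (rule ext)
    have "\<eta> x = - (\<Sum>b\<in>B. \<eta> b * f (0, \<beta> b))"
      by (simp add: x_def \<eta>.neg \<eta>.sum \<eta>.scale mult.commute)
    then have "\<eta> x = - f (0, \<eta>)"
      using sums[OF finite_Basis, of \<eta>] unfolding eta by simp
    moreover have "f (y, \<eta>) = f (y, 0) + f (0, \<eta>)"
      using add[OF z, of "(0, \<eta>)" y] \<eta> by (simp add: dsum_def)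
    ultimately show "std_form (x, \<xi>) q = f q"
      by (simp add: std_form_def \<xi>_def)
  qed
qed

text \<open>For fixed \<open>u\<close> and \<open>v\<close> the map sending \<open>w\<close> to
  \<open>std_form v (br u w)\<close> is linear, so it is represented by an element of
  \<open>dsum sc\<close>, unique by nondegeneracy.\<close>

lemma ex1_product_of_bracket:
  assumes "finite_dimensional_vector_space sc B"
    and "symplectic_mock_Lie_algebra (dsum_scale sc) (dsum sc) br std_form"
  shows "\<exists>!P. zero_off (dsum sc) P \<and> product_of_bracket (dsum sc) std_form br P"
proof -
  interpret symplectic_mock_Lie_algebra "dsum_scale sc" "dsum sc" br std_form by fact
  note [simp] = subspace_add[OF subspace_V] subspace_scale[OF subspace_V]
  have "\<exists>p\<in>dsum sc. \<forall>w\<in>dsum sc. std_form p w = std_form v (br u w)"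
    if "u \<in> dsum sc" "v \<in> dsum sc" for u v
    using assms(1) by (rule std_form_represents) (use that in \<open>simp_all add: br_add br_scale\<close>)
  then obtain R where R: "R u v \<in> dsum sc \<and>
      (\<forall>w\<in>dsum sc. std_form (R u v) w = std_form v (br u w))"
    if "u \<in> dsum sc" "v \<in> dsum sc" for u v by metis
  show ?thesis
  proof (rule ex1I[of _ "\<lambda>u v. if u \<in> dsum sc \<and> v \<in> dsum sc then R u v else 0"])
    show "zero_off (dsum sc) (\<lambda>u v. if u \<in> dsum sc \<and> v \<in> dsum sc then R u v else 0) \<and>
        product_of_bracket (dsum sc) std_form br
          (\<lambda>u v. if u \<in> dsum sc \<and> v \<in> dsum sc then R u v else 0)" (is "?Z \<and> ?Q")
      using R by (simp add: zero_off_def product_of_bracket_def)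
    then have Q: ?Q ..
    fix P assume P: "zero_off (dsum sc) P \<and> product_of_bracket (dsum sc) std_form br P"
    show "P = (\<lambda>u v. if u \<in> dsum sc \<and> v \<in> dsum sc then R u v else 0)"
    proof (intro ext)
      fix u v
      show "P u v = (if u \<in> dsum sc \<and> v \<in> dsum sc then R u v else 0)"
        using P product_of_bracket_cong[OF _ Q, of br P u v] unfolding zero_off_def by presburger
    qed
  qed
qed

section \<open>Manin triples and phase spaces\<close>

text \<open>The axioms for \<open>bg\<close> are those for \<open>br\<close> read along the
  embedding of \<open>x\<close> as \<open>(x, 0)\<close>.\<close>

lemma mock_Lie_base:
  assumes "fin_dim_space sc UNIV"
    and "mock_Lie_algebra (dsum_scale sc) (dsum sc) br"
    and bg: "\<And>x y. br (x, 0) (y, 0) = (bg x y, 0)"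
  shows "mock_Lie_algebra sc UNIV bg"
proof -
  interpret fin_dim_space sc UNIV by fact
  interpret D: mock_Lie_algebra "dsum_scale sc" "dsum sc" br by fact
  have z: "(x, 0) \<in> dsum sc" for x
    using zero_mem_dual_space[OF vector_space_axioms] by (simp add: dsum_def)
  have bil: "br (p + q) r = br p r + br q r" "br r (p + q) = br r p + br r q"
      "br (dsum_scale sc c p) q = dsum_scale sc c (br p q)"
      "br p (dsum_scale sc c q) = dsum_scale sc c (br p q)"
    if "p \<in> dsum sc" "q \<in> dsum sc" "r \<in> dsum sc" for p q r c
    using D.bilinear_br that unfolding bilinear_on_def by blast+
  note dscale = dsum_scale_Pair[OF vector_space_axioms]
  show ?thesis
  proof
    have "bg (x + y) w = bg x w + bg y w" "bg x (y + w) = bg x y + bg x w" for x y w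
      using bil(1)[OF z[of x] z[of y] z[of w]] bil(2)[OF z[of y] z[of w] z[of x]]
      by (simp_all add: bg)
    moreover have "bg (sc c x) y = sc c (bg x y)" "bg x (sc c y) = sc c (bg x y)" for c x y
      using bil(3,4)[OF z[of x] z[of y] z[of 0], of c]
      by (simp_all add: dscale bg flip: zero_fun_def)
    ultimately show "bilinear_on sc UNIV sc UNIV bg"
      unfolding bilinear_on_def by simp
    show "bg x y = bg y x" for x y
      using D.br_sym[OF z[of x] z[of y]] by (simp add: bg)
    show "bg x (bg y w) + bg y (bg w x) + bg w (bg x y) = 0" for x y w
      using D.br_jacobi[OF z[of x] z[of y] z[of w]] by (simp add: bg zero_prod_def)
  qed
qed

lemma phase_space_of_Manin_triple:
  assumes "fin_dim_space sc UNIV" "std_Manin_triple sc P"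
  shows "phase_space sc (sub_adjacent (induced_op P)) (sub_adjacent P)"
proof -
  interpret fin_dim_space sc UNIV by fact
  interpret M: Manin_triple "dsum_scale sc" "dsum sc" P std_form base_part "dual_part sc"
    by fact
  have sub: "subalgebra (dsum_scale sc) (dsum sc) (sub_adjacent P) H"
    if "subalgebra (dsum_scale sc) (dsum sc) P H" for H
    using that M.subspace_add by (auto simp: subalgebra_def sub_adjacent_def)
  have bg: "sub_adjacent P (x, 0) (y, 0) = (sub_adjacent (induced_op P) x y, 0)" for x y
  proof -
    \<comment> \<open>Closure of \<open>base_part\<close> ensures that the component dropped by
      \<open>induced_op\<close> is zero.\<close>
    have "P (a, 0) (b, 0) \<in> base_part" for a b
      using M.subalgebra_g by (simp add: subalgebra_def base_part_def)
    then have "P (a, 0) (b, 0) = (induced_op P a b, 0)" for a b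
      by (metis base_part_def induced_op_def mem_Times_iff prod.collapse singletonD)
    then show ?thesis by (simp add: sub_adjacent_def)
  qed
  show ?thesis
    unfolding phase_space_def
    using M.symplectic_sub_adjacent sub[OF M.subalgebra_g] sub[OF M.subalgebra_g'] bg
      mock_Lie_base[OF assms(1) M.mock_Lie_sub_adjacent bg] by blast
qed

lemma Manin_triple_of_phase_space:
  assumes "phase_space sc bg br" "product_of_bracket (dsum sc) std_form br P"
  shows "std_Manin_triple sc P"
proof -
  note ph = assms(1)[unfolded phase_space_def]
  interpret g: mock_Lie_algebra sc UNIV bg using ph by blast
  interpret S: symplectic_mock_Lie_algebra "dsum_scale sc" "dsum sc" br std_form
    using ph by blast
  interpret Q: quadratic_mock_pre_Lie_algebra "dsum_scale sc" "dsum sc" P std_form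
    by (rule S.quadratic_product) fact
  note vs = g.vector_space_axioms
  note iso = std_form_isotropic[OF vs]
  have base: "subalgebra (dsum_scale sc) (dsum sc) br base_part"
    and dual: "subalgebra (dsum_scale sc) (dsum sc) br (dual_part sc)"
    using ph by blast+
  note P = S.product_of_bracketD[OF assms(2)]
  \<comment> \<open>The pairing of \<open>P p q\<close> with \<open>r\<close> is that of
    \<open>q\<close> with \<open>br p r\<close>. All of these lie in the base part, as
    \<open>br\<close> preserves it, so isotropy makes the pairing zero. The dual part is treated
    alike.\<close>
  have "P p q \<in> base_part" if "p \<in> base_part" "q \<in> base_part" for p q
  proof (rule base_part_perp)
    fix r :: "'b \<times> ('b \<Rightarrow> 'a)" assume "r \<in> base_part"
    then show "std_form (P p q) r = 0"
      using that base base_part_subset[OF vs] by (subst P) (auto simp: subalgebra_def intro: iso)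
  qed
  moreover have "P p q \<in> dual_part sc" if "p \<in> dual_part sc" "q \<in> dual_part sc" for p q
  proof (rule dual_part_perp[OF S.skew_form_space_axioms vs])
    show "P p q \<in> dsum sc" using that dual_part_subset[of sc] by (intro P) auto
    fix r assume "r \<in> dual_part sc"
    then show "std_form (P p q) r = 0"
      using that dual dual_part_subset[of sc] by (subst P) (auto simp: subalgebra_def intro: iso)
  qed
  ultimately have "subalgebra (dsum_scale sc) (dsum sc) P base_part"
    "subalgebra (dsum_scale sc) (dsum sc) P (dual_part sc)"
    using base dual by (simp_all add: subalgebra_def)
  then have "Manin_triple_axioms (dsum_scale sc) (dsum sc) P std_form base_part (dual_part sc)"
    by (intro Manin_triple_axioms.intro dsum_direct_sum[OF vs]) (assumption | erule (1) iso)+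
  with Q.quadratic_mock_pre_Lie_algebra_axioms show ?thesis
    by (rule Manin_triple.intro)
qed

lemma bij_betw_Manin_triples_phase_spaces:
  assumes "finite_dimensional_vector_space sc B"
  shows "bij_betw (\<lambda>P. (sub_adjacent (induced_op P), sub_adjacent P))
    {P. zero_off (dsum sc) P \<and> std_Manin_triple sc P}
    {(bg, br). zero_off (dsum sc) br \<and> phase_space sc bg br}"
    (is "bij_betw ?F ?M ?S")
proof -
  interpret finite_dimensional_vector_space sc B by fact
  have fd: "fin_dim_space sc UNIV"
    by unfold_locales (use finite_Basis span_Basis in auto)
  show ?thesis
  proof (rule bij_betwI')
    fix P Q assume P: "P \<in> ?M" and Q: "Q \<in> ?M"
    show "?F P = ?F Q \<longleftrightarrow> P = Q"
    proof
      assume eq: "?F P = ?F Q"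
      interpret M: Manin_triple "dsum_scale sc" "dsum sc" P std_form base_part "dual_part sc"
        using P by blast
      interpret N: Manin_triple "dsum_scale sc" "dsum sc" Q std_form base_part "dual_part sc"
        using Q by blast
      show "P = Q"
      proof (intro ext)
        fix u v
        show "P u v = Q u v"
        proof (cases "u \<in> dsum sc \<and> v \<in> dsum sc")
          case True
          with eq show ?thesis
            \<comment> \<open>Injectivity needs only the second components: the quadratic condition
              recovers each product from its sub-adjacent bracket.\<close>
            using M.product_of_bracket_cong[OF M.product_of_sub_adjacent
                N.product_of_sub_adjacent, of u v] by simp
        next
          case False
          with P Q have "P u v = 0" "Q u v = 0"
            unfolding zero_off_def by blast+
          then show ?thesis by simp
        qed
      qed
    qed simp
  next
    fix P assume "P \<in> ?M"
    then show "?F P \<in> ?S"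
      using phase_space_of_Manin_triple[OF fd] zero_off_sub_adjacent by blast
  next
    fix s assume "s \<in> ?S"
    then obtain bg br where [simp]: "s = (bg, br)"
      and br: "zero_off (dsum sc) br" "phase_space sc bg br" by auto
    interpret S: symplectic_mock_Lie_algebra "dsum_scale sc" "dsum sc" br std_form
      using br(2) by (simp add: phase_space_def)
    obtain P where P: "zero_off (dsum sc) P" "product_of_bracket (dsum sc) std_form br P"
      using ex1_product_of_bracket[OF assms S.symplectic_mock_Lie_algebra_axioms] by blast
    have M: "std_Manin_triple sc P"
      using br(2) P(2) by (rule Manin_triple_of_phase_space)
    \<comment> \<open>Surjectivity asks for equality of total functions; outside
      \<open>dsum sc\<close> both sides vanish by the \<open>zero_off\<close> normalization.\<close>
    have "sub_adjacent P u v = br u v" for u v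
    proof (cases "u \<in> dsum sc \<and> v \<in> dsum sc")
      case True
      then show ?thesis using S.sub_adjacent_product[OF P(2)] by simp
    next
      case False
      then have "P u v = 0" "P v u = 0" "br u v = 0"
        using P(1) br(1) unfolding zero_off_def by blast+
      then show ?thesis by (simp add: sub_adjacent_def)
    qed
    then have eq: "sub_adjacent P = br" by blast
    \<comment> \<open>The bracket on g is already determined by \<open>br\<close>, through its
      values on pairs \<open>(x, 0)\<close>, \<open>(y, 0)\<close>.\<close>
    have "sub_adjacent (induced_op P) x y = bg x y" for x y
    proof -
      have "sub_adjacent (induced_op P) x y = fst (sub_adjacent P (x, 0) (y, 0))"
        by (simp add: sub_adjacent_def induced_op_def)
      also have "\<dots> = bg x y" using br(2) by (simp add: eq phase_space_def)
      finally show ?thesis .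
    qed
    then have "sub_adjacent (induced_op P) = bg" by blast
    with eq P(1) M show "\<exists>P\<in>?M. s = ?F P" by (intro bexI[of _ P]) simp_all
  qed
qed

theorem theorem2p25:
  fixes sc :: "'k::{alg_closed_field, field_char_0} \<Rightarrow> 'v::ab_group_add \<Rightarrow> 'v"
  assumes "\<exists>Basis. finite_dimensional_vector_space sc Basis"
  shows
    "(\<forall>P. std_Manin_triple sc P \<longrightarrow>
        phase_space sc (sub_adjacent (induced_op P)) (sub_adjacent P)) \<and>
     (\<forall>bg br. phase_space sc bg br \<longrightarrow>
        (\<exists>!P. zero_off (dsum sc) P \<and> product_of_bracket (dsum sc) std_form br P) \<and>
        (\<forall>P. product_of_bracket (dsum sc) std_form br P \<longrightarrow>
           std_Manin_triple sc P \<and>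
           (\<forall>u\<in>dsum sc. \<forall>v\<in>dsum sc. sub_adjacent P u v = br u v))) \<and>
     bij_betw (\<lambda>P. (sub_adjacent (induced_op P), sub_adjacent P))
       {P. zero_off (dsum sc) P \<and> std_Manin_triple sc P}
       {(bg, br). zero_off (dsum sc) br \<and> phase_space sc bg br}"
proof -
  obtain B where B: "finite_dimensional_vector_space sc B" using assms by blast
  then interpret finite_dimensional_vector_space sc B .
  have fd: "fin_dim_space sc UNIV"
    by unfold_locales (use finite_Basis span_Basis in auto)
  show ?thesis
  proof (intro conjI allI impI)
    fix P assume "std_Manin_triple sc P"
    with fd show "phase_space sc (sub_adjacent (induced_op P)) (sub_adjacent P)"
      by (rule phase_space_of_Manin_triple)
  next
    fix bg br assume ph: "phase_space sc bg br"
    then interpret S: symplectic_mock_Lie_algebra "dsum_scale sc" "dsum sc" br std_form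
      by (simp add: phase_space_def)
    show "\<exists>!P. zero_off (dsum sc) P \<and> product_of_bracket (dsum sc) std_form br P"
      using B S.symplectic_mock_Lie_algebra_axioms by (rule ex1_product_of_bracket)
    fix P assume P: "product_of_bracket (dsum sc) std_form br P"
    with ph show "std_Manin_triple sc P" by (rule Manin_triple_of_phase_space)
    show "\<forall>u\<in>dsum sc. \<forall>v\<in>dsum sc. sub_adjacent P u v = br u v"
      using S.sub_adjacent_product[OF P] by blast
  qed (rule bij_betw_Manin_triples_phase_spaces[OF B])
qed

end
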